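(* Let $\lambda\in\left[0,\frac{2}{\sqrt{3}}\right]$. Then there exists a set of cardinality of the continuum of vectors $\mathbf{v}\in\mathbb{R}^2$ whose sequence of best approximations $(q_n,\mathbf{p}_n)_{n\geqslant 0}$ is infinite and satisfies $$\lim_{n\to\infty}\frac{1}{\pi}V_{n+1}=\lim_{n\to\infty} q_{n+1}\,|q_n\mathbf{v}-\mathbf{p}_n|^2=\lambda .$$
   Context: For $x\in\mathbb{R}$, $\|x\|$ is the distance from $x$ to the nearest integer, and $|\cdot|$ is the Euclidean norm on $\mathbb{R}^2$. For $\mathbf{v}=(v_1,v_2)\in\mathbb{R}^2$, the sequence of best approximations (Euclidean norm) is defined by: $q_0=1$; $q_{n+1}=\min\{q\in\mathbb{N}: \sqrt{\|qv_1\|^2+\|qv_2\|^2}<\sqrt{\|q_nv_1\|^2+\|q_nv_2\|^2}\}$ (as long as this set is nonempty); and $\mathbf{p}_n=(p_{n,1},p_{n,2})\in\mathbb{Z}^2$ with $|q_nv_1-p_{n,1}|=\|q_nv_1\|$, $|q_nv_2-p_{n,2}|=\|q_nv_2\|$. Thus $|q_n\mathbf{v}-\mathbf{p}_n|=\sqrt{\|q_nv_1\|^2+\|q_nv_2\|^2}$ does not depend on the choice of $\mathbf{p}_n$. For $n\geqslant 1$ set $R_n=|q_{n-1}\mathbf{v}-\mathbf{p}_{n-1}|$ and $V_n=\pi q_n R_n^2$ (the volume of the cylinder $\{(q,\mathbf{p})\in\mathbb{R}\times\mathbb{R}^2: 0\leqslant q\leqslant q_n,\ |q\mathbf{v}-\mathbf{p}|\leqslant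 R_n\}$). *)

theory Defs
  imports "HOL-Analysis.Analysis" "HOL-Library.Equipollence"
begin

abbreviation dist_int :: "real \<Rightarrow> real" where
  "dist_int x \<equiv> infdist x \<int>"

definition approx_err :: "real ^ 2 \<Rightarrow> nat \<Rightarrow> real" where
  "approx_err v q = sqrt ((dist_int (real q * v $ 1))\<^sup>2 + (dist_int (real q * v $ 2))\<^sup>2)"

text \<open>Denominators are positive: admitting \<open>q = 0\<close>, whose error is 0, would make the
  recursion for the best approximations degenerate.\<close>

definition better_denoms :: "real ^ 2 \<Rightarrow> nat \<Rightarrow> nat set" where
  "better_denoms v Q = {q. 0 < q \<and> approx_err v q < approx_err v Q}"

text \<open>The value \<open>best_denom v (Suc n)\<close> is meaningful only as long as the set of better
  denominators is nonempty; \<open>infinite_best_approx v\<close> says that this never fails.\<close>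

primrec best_denom :: "real ^ 2 \<Rightarrow> nat \<Rightarrow> nat" where
  "best_denom v 0 = 1"
| "best_denom v (Suc n) = (LEAST q. q \<in> better_denoms v (best_denom v n))"

definition infinite_best_approx :: "real ^ 2 \<Rightarrow> bool" where
  "infinite_best_approx v \<longleftrightarrow> (\<forall>n. better_denoms v (best_denom v n) \<noteq> {})"

text \<open>The numerators need not be unique, since a coordinate may lie halfway between two
  integers, so they are described by a predicate.\<close>

definition best_numerators :: "real ^ 2 \<Rightarrow> (nat \<Rightarrow> int ^ 2) \<Rightarrow> bool" where
  "best_numerators v p \<longleftrightarrow>
     (\<forall>n i. \<bar>real (best_denom v n) * v $ i - of_int (p n $ i)\<bar>
            = dist_int (real (best_denom v n) * v $ i))"

definition best_dist :: "real ^ 2 \<Rightarrow> (nat \<Rightarrow> int ^ 2) \<Rightarrow> nat \<Rightarrow> real" where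
  "best_dist v p n = norm (real (best_denom v n) *\<^sub>R v - (\<chi> i. of_int (p n $ i)))"

text \<open>Both of the following are used for \<open>n \<ge> 1\<close> only.\<close>

definition cyl_radius :: "real ^ 2 \<Rightarrow> (nat \<Rightarrow> int ^ 2) \<Rightarrow> nat \<Rightarrow> real" where
  "cyl_radius v p n = best_dist v p (n - 1)"

definition cyl_volume :: "real ^ 2 \<Rightarrow> (nat \<Rightarrow> int ^ 2) \<Rightarrow> nat \<Rightarrow> real" where
  "cyl_volume v p n = pi * real (best_denom v n) * (cyl_radius v p n)\<^sup>2"

lemma dist_int_eq_round: "dist_int x = \<bar>x - of_int (round x)\<bar>"
proof (rule antisym)
  have ne: "(\<int> :: real set) \<noteq> {}" using Ints_0 by blast
  show "dist_int x \<le> \<bar>x - of_int (round x)\<bar>"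
    using infdist_le[of "of_int (round x)" "\<int>" x] by (simp add: dist_real_def)
  show "\<bar>x - of_int (round x)\<bar> \<le> dist_int x"
    unfolding infdist_notempty[OF ne]
  proof (rule cINF_greatest[OF ne])
    fix a :: real assume "a \<in> \<int>"
    then obtain m where "a = of_int m" by (auto elim: Ints_cases)
    then show "\<bar>x - of_int (round x)\<bar> \<le> dist x a"
      using round_diff_minimal[of x m] by (simp add: dist_real_def)
  qed
qed

lemma best_numerators_exist: "\<exists>p. best_numerators v p"
  by (rule exI[of _ "\<lambda>n. \<chi> i. round (real (best_denom v n) * v $ i)"])
     (simp add: best_numerators_def dist_int_eq_round)

lemma best_dist_eq_approx_err:
  "best_numerators v p \<Longrightarrow> best_dist v p n = approx_err v (best_denom v n)"
  by (simp add: best_numerators_def best_dist_def approx_err_def norm_vec_def L2_set_def sum_2)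

end

theory Submission
  imports Defs "HOL-Real_Asymp.Real_Asymp"
begin

text \<open>
  The vectors are limits of rational points \<open>w\<^sub>n = (p\<^sub>n / q\<^sub>n, P\<^sub>n / q\<^sub>n)\<close>, where \<open>p\<^sub>n / q\<^sub>n\<close> are the
  convergents of a continued fraction and \<open>P\<^sub>n\<close> is free. Put \<open>Q = q\<^sub>n\<^sub>+\<^sub>1\<close> and
  \<open>D = P\<^sub>n\<^sub>+\<^sub>1 q\<^sub>n - P\<^sub>n Q\<close>. The lattice \<open>\<int> w\<^sub>n\<^sub>+\<^sub>1 + \<int>\<^sup>2\<close> is spanned by
  \<open>(\<plusminus>1/Q, D/Q)\<close>, which comes from the denominator \<open>q\<^sub>n\<close>, and \<open>(0, 1)\<close>. If \<open>Q\<close> is about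
  \<open>(1 + D\<^sup>2) / \<lambda>\<close> with \<open>\<lambda> < 2 / \<surd>3\<close>, and \<open>D Q / (1 + D\<^sup>2)\<close> is about half an odd integer, then the
  first vector is, up to sign, the unique shortest one, and \<open>Q\<close> times its squared length is about
  \<open>\<lambda>\<close>. Taking \<open>D\<close> large makes \<open>w\<^sub>n\<^sub>+\<^sub>1\<close> so close to \<open>w\<^sub>n\<close> that all earlier strict inequalities
  survive. The only competing denominator below \<open>Q\<close> is \<open>Q - q\<^sub>n\<close>; if it does occur as a best
  approximation, this is harmless because it is asymptotic to \<open>Q\<close>. The sign of each \<open>D\<close> can be
  prescribed and is read off the limit as the side of \<open>P\<^sub>n / q\<^sub>n\<close> on which its second coordinate
  lies, which yields continuum many vectors.
\<close>


section \<open>Choice of the lattice parameters \<open>E\<close> and \<open>Q\<close>\<close>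

text \<open>\<open>lo\<close> and \<open>hi\<close> will bound \<open>Q / (1 + E\<^sup>2)\<close>,
  and \<open>\<eta>\<close> the excess of \<open>E * Q / (1 + E\<^sup>2)\<close> over a
  half-integer. The first two tend to \<open>1 / c\<close> and \<open>\<eta>\<close> to 0, so most
  conjuncts hold because they hold strictly in the limit; the last two compare growth rates in
  \<open>E\<close>. The bound on \<open>c\<close> enters as
  \<open>1 < 1 / c\<^sup>2 + 1/4\<close>.\<close>

lemma large_parameter_bounds:
  fixes c \<epsilon> \<delta> q :: real
  assumes c: "0 < c" "c < 2 / sqrt 3" and e: "0 < \<epsilon>" "\<epsilon> < 1" and d: "0 < \<delta>" and q: "0 < q"
  defines "lo \<equiv> \<lambda>E::real. 1 / c - 1 / (2 * E)"
    and "hi \<equiv> \<lambda>E::real. 1 / c + 1 / (2 * E) + q / (1 + E\<^sup>2)"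
    and "\<eta> \<equiv> \<lambda>E::real. q * E / (1 + E\<^sup>2)"
  shows "\<forall>\<^sub>F E in at_top. 0 < lo E \<and> 1 < (lo E)\<^sup>2 + (1/2 - \<eta> E)\<^sup>2 \<and> \<eta> E < 1/2 \<and>
    c * (1 - \<epsilon>) * hi E < 1 \<and> 1 < c * (1 + \<epsilon>) * lo E \<and>
    q < \<epsilon> * (lo E * (1 + E\<^sup>2)) \<and> 1 + E < \<delta> * q * (lo E * (1 + E\<^sup>2))"
proof -
  have "c\<^sup>2 < (2 / sqrt 3)\<^sup>2" using c by (intro power_strict_mono) auto
  then have c2: "1 < 1 / c\<^sup>2 + 1/4" using c by (simp add: power_divide field_simps)
  have lo: "(lo \<longlongrightarrow> 1 / c) at_top" and hi: "(hi \<longlongrightarrow> 1 / c) at_top" and eta: "(\<eta> \<longlongrightarrow> 0) at_top"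
    unfolding lo_def hi_def \<eta>_def by real_asymp+
  have "((\<lambda>E. (lo E)\<^sup>2 + (1/2 - \<eta> E)\<^sup>2) \<longlongrightarrow> (1/c)\<^sup>2 + (1/2 - 0)\<^sup>2) at_top"
    by (intro tendsto_intros lo eta)
  then have 1: "\<forall>\<^sub>F E in at_top. 1 < (lo E)\<^sup>2 + (1/2 - \<eta> E)\<^sup>2"
    by (rule order_tendstoD) (use c2 in \<open>simp add: power_divide\<close>)
  have "((\<lambda>E. c * (1 - \<epsilon>) * hi E) \<longlongrightarrow> c * (1 - \<epsilon>) * (1 / c)) at_top"
    by (intro tendsto_intros hi)
  then have 2: "\<forall>\<^sub>F E in at_top. c * (1 - \<epsilon>) * hi E < 1"
    by (rule order_tendstoD) (use c e in simp)
  have "((\<lambda>E. c * (1 + \<epsilon>) * lo E) \<longlongrightarrow> c * (1 + \<epsilon>) * (1 / c)) at_top"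
    by (intro tendsto_intros lo)
  then have 3: "\<forall>\<^sub>F E in at_top. 1 < c * (1 + \<epsilon>) * lo E"
    by (rule order_tendstoD) (use c e in simp)
  have 4: "\<forall>\<^sub>F E in at_top. q < \<epsilon> * (lo E * (1 + E\<^sup>2))"
    unfolding lo_def using c e by real_asymp
  have 5: "\<forall>\<^sub>F E in at_top. 1 + E < \<delta> * q * (lo E * (1 + E\<^sup>2))"
    unfolding lo_def using c d q by real_asymp
  have 6: "\<forall>\<^sub>F E in at_top. 0 < lo E" by (rule order_tendstoD(1)[OF lo]) (use c in simp)
  have 7: "\<forall>\<^sub>F E in at_top. \<eta> E < 1/2" by (rule order_tendstoD(2)[OF eta]) simp
  show ?thesis using 1 2 3 4 5 6 7 by eventually_elim simp
qed

lemma exists_cong_in_interval: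
  fixes q c :: int and T :: real
  assumes "0 < q"
  obtains Q where "q dvd Q - c" "T \<le> Q" "Q < T + q"
proof
  let ?Q = "\<lceil>T\<rceil> + (c - \<lceil>T\<rceil>) mod q"
  have "q dvd (c - \<lceil>T\<rceil>) - (c - \<lceil>T\<rceil>) mod q" by (simp only: dvd_minus_mod)
  then show "q dvd ?Q - c" by (smt (verit) dvd_minus_iff)
  have "0 \<le> (c - \<lceil>T\<rceil>) mod q" "(c - \<lceil>T\<rceil>) mod q \<le> q - 1" using assms by (auto simp: pos_mod_bound)
  then show "T \<le> real_of_int ?Q" "real_of_int ?Q < T + q" by linarith+
qed

text \<open>With \<open>M = 1 + E\<^sup>2\<close> the form below is \<open>M ((i + j E Q / M)\<^sup>2 + (j Q / M)\<^sup>2)\<close>.\<close>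

lemma form_exceeds_minimum:
  fixes E Q i j k :: int and \<rho> \<eta> :: real
  assumes \<rho>: "0 < \<rho>" "\<rho> * (1 + E\<^sup>2) \<le> Q" and \<eta>: "\<eta> < 1/2" and big: "1 < \<rho>\<^sup>2 + (1/2 - \<eta>)\<^sup>2"
    and shift: "k + 1/2 \<le> E * Q / (1 + (real_of_int E)\<^sup>2)"
      "E * Q / (1 + (real_of_int E)\<^sup>2) \<le> k + 1/2 + \<eta>"
    and ij: "(i, j) \<notin> {(0, 0), (1, 0), (-1, 0)}"
  shows "1 + E\<^sup>2 < i\<^sup>2 + (i * E + j * Q)\<^sup>2"
proof -
  define M where "M = 1 + (real_of_int E)\<^sup>2"
  define \<theta> where "\<theta> = E * Q / M"
  have M: "0 < M" unfolding M_def by (simp add: add_pos_nonneg)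
  have r: "\<rho> \<le> Q / M" using \<rho> M by (simp add: M_def field_simps)
  have form: "real_of_int (i\<^sup>2 + (i * E + j * Q)\<^sup>2) = M * ((i + j * \<theta>)\<^sup>2 + j\<^sup>2 * (Q / M)\<^sup>2)"
  proof -
    have "M * ((i + j * \<theta>)\<^sup>2 + j\<^sup>2 * (Q / M)\<^sup>2) = M * i\<^sup>2 + 2 * i * j * E * Q + j\<^sup>2 * Q\<^sup>2 * ((E\<^sup>2 + 1) / M)"
      using M unfolding \<theta>_def by (simp add: power2_eq_square field_simps)
    also have "(E\<^sup>2 + 1) / M = 1" using M by (simp add: M_def)
    finally show ?thesis unfolding M_def by (simp add: power2_eq_square algebra_simps)
  qed
  have eta0: "0 \<le> \<eta>" using shift by linarith
  then have "(1/2 - \<eta>)\<^sup>2 \<le> (1/2)\<^sup>2" using \<eta> by (intro power_mono) auto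
  then have r34: "3/4 < \<rho>\<^sup>2" using big by (simp add: power_divide)
  have rr: "\<rho>\<^sup>2 \<le> (Q / M)\<^sup>2" using r \<rho> by (intro power_mono) auto
  have "1 < (i + j * \<theta>)\<^sup>2 + j\<^sup>2 * (Q / M)\<^sup>2"
  proof -
    \<comment> \<open>For \<open>j = 0\<close> only \<open>i\<close> with absolute value at least 2
      remains. For \<open>j\<close> of absolute value 1, \<open>\<theta>\<close> is within
      \<open>\<eta>\<close> of a half-integer, so every integer is at least
      \<open>1/2 - \<eta>\<close> away from it. For larger \<open>j\<close> the second term is at
      least \<open>4 * \<rho>\<^sup>2\<close>, which exceeds 3.\<close>
    consider "j = 0" | "\<bar>j\<bar> = 1" | "2 \<le> \<bar>j\<bar>" by linarith
    then show ?thesis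
    proof cases
      case 1
      then have "2 \<le> \<bar>i\<bar>" using ij by auto
      then have "2\<^sup>2 \<le> \<bar>i\<bar>\<^sup>2" by (intro power_mono) auto
      then have "4 \<le> i\<^sup>2" by simp
      then have "4 \<le> (real_of_int i)\<^sup>2" by (metis of_int_le_iff of_int_numeral of_int_power)
      then show ?thesis using 1 by simp
    next
      case 2
      have th: "k + 1/2 \<le> \<theta>" "\<theta> \<le> k + 1/2 + \<eta>" using shift by (simp_all add: \<theta>_def M_def)
      have "j = 1 \<or> j = -1" using 2 by linarith
      then have abs: "\<bar>i + j * \<theta>\<bar> = \<bar>j * i + \<theta>\<bar>" by auto
      have "1/2 - \<eta> \<le> \<bar>(j * i + k) + (\<theta> - k)\<bar>"
      proof (cases "0 \<le> j * i + k")
        case True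
        then have "0 \<le> real_of_int (j * i + k)" by (simp only: of_int_0_le_iff)
        then show ?thesis using th eta0 by linarith
      next
        case False
        then have "real_of_int (j * i + k) \<le> -1" by linarith
        then show ?thesis using th eta0 \<eta> by linarith
      qed
      then have "1/2 - \<eta> \<le> \<bar>i + j * \<theta>\<bar>" unfolding abs by (simp add: algebra_simps)
      then have "(1/2 - \<eta>)\<^sup>2 \<le> \<bar>i + j * \<theta>\<bar>\<^sup>2" using \<eta> by (intro power_mono) auto
      moreover have "j\<^sup>2 = 1" using \<open>j = 1 \<or> j = -1\<close> by auto
      then have "(real_of_int j)\<^sup>2 = 1" by (metis of_int_1 of_int_power)
      ultimately show ?thesis using big rr by simp
    next
      case 3
      then have "2\<^sup>2 \<le> \<bar>j\<bar>\<^sup>2" by (intro power_mono) auto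
      then have "4 \<le> j\<^sup>2" by simp
      then have "4 \<le> (real_of_int j)\<^sup>2" by (metis of_int_le_iff of_int_numeral of_int_power)
      then have "4 * \<rho>\<^sup>2 \<le> (real_of_int j)\<^sup>2 * (Q / M)\<^sup>2" using rr by (intro mult_mono) auto
      then show ?thesis using r34 zero_le_power2[of "i + j * \<theta>"]
        unfolding of_int_power by linarith
    qed
  qed
  then have "M * 1 < real_of_int (i\<^sup>2 + (i * E + j * Q)\<^sup>2)"
    unfolding form using M by (intro mult_strict_left_mono)
  then have "real_of_int (1 + E\<^sup>2) < real_of_int (i\<^sup>2 + (i * E + j * Q)\<^sup>2)" by (simp add: M_def)
  then show ?thesis by (simp only: of_int_less_iff)
qed

text \<open>Moving \<open>Q\<close> into a residue class mod \<open>q\<close> costs less than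
  \<open>q\<close>, which is negligible against \<open>1 + E\<^sup>2\<close>; so every large
  \<open>E\<close> works with any residue. The bound on \<open>q\<close> will control the mirror
  denominator \<open>Q - q\<close>, and the bound on \<open>1 + E\<close> will keep the next centre
  in a ball of radius \<open>\<delta>\<close>.\<close>

lemma exists_lattice_parameters:
  fixes c \<epsilon> \<delta> :: real and q :: nat
  assumes c: "0 < c" "c < 2 / sqrt 3" and e: "0 < \<epsilon>" "\<epsilon> < 1" and d: "0 < \<delta>" and q: "0 < q"
  obtains E0 :: int where "\<And>(E::int) r. E0 \<le> E \<Longrightarrow> \<exists>Q::int. int q dvd Q - r \<and> q < \<epsilon> * Q \<and>
    c * (1 - \<epsilon>) * Q < 1 + E\<^sup>2 \<and> 1 + E\<^sup>2 < c * (1 + \<epsilon>) * Q \<and> 1 + E < \<delta> * (q * Q) \<and>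
    (\<forall>i j. (i, j) \<notin> {(0, 0), (1, 0), (-1, 0)} \<longrightarrow> 1 + E\<^sup>2 < i\<^sup>2 + (i * E + j * Q)\<^sup>2)"
proof -
  let ?lo = "\<lambda>E::real. 1 / c - 1 / (2 * E)"
  let ?hi = "\<lambda>E::real. 1 / c + 1 / (2 * E) + q / (1 + E\<^sup>2)"
  let ?\<eta> = "\<lambda>E::real. q * E / (1 + E\<^sup>2)"
  have "real q > 0" using q by simp
  from large_parameter_bounds[OF c e d this] obtain E0 where E0: "\<And>E. E0 \<le> E \<Longrightarrow>
     0 < ?lo E \<and> 1 < (?lo E)\<^sup>2 + (1/2 - ?\<eta> E)\<^sup>2 \<and> ?\<eta> E < 1/2 \<and>
    c * (1 - \<epsilon>) * ?hi E < 1 \<and> 1 < c * (1 + \<epsilon>) * ?lo E \<and>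
    q < \<epsilon> * (?lo E * (1 + E\<^sup>2)) \<and> 1 + E < \<delta> * q * (?lo E * (1 + E\<^sup>2))"
    unfolding eventually_at_top_linorder by blast
  show ?thesis
  proof (rule that)
    fix E r :: int assume "max 1 \<lceil>E0\<rceil> \<le> E"
    then have E: "1 \<le> E" "E0 \<le> E" by linarith+
    define x where "x = real_of_int E"
    define M where "M = 1 + x\<^sup>2"
    define k where "k = \<lfloor>x / c\<rfloor>"
    have x: "1 \<le> x" using E by (simp add: x_def)
    have M: "0 < M" "1 < M" unfolding M_def using x by (auto simp: add_pos_nonneg)
    from E0[OF E(2)] have b: "0 < ?lo x" "1 < (?lo x)\<^sup>2 + (1/2 - ?\<eta> x)\<^sup>2" "?\<eta> x < 1/2"
      "c * (1 - \<epsilon>) * ?hi x < 1" "1 < c * (1 + \<epsilon>) * ?lo x"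
      "q < \<epsilon> * (?lo x * M)" "1 + x < \<delta> * q * (?lo x * M)" by (simp_all add: x_def M_def)
    \<comment> \<open>Chosen so that \<open>x * T / M\<close> is exactly \<open>k + 1/2\<close>; as
      \<open>k\<close> is the floor of \<open>x / c\<close>, the ratio \<open>T / M\<close> is
      within \<open>1 / (2 * x)\<close> of \<open>1 / c\<close>.\<close>
    define T where "T = M * (2 * k + 1) / (2 * x)"
    obtain Q where Q: "int q dvd Q - r" "T \<le> Q" "Q < T + int q"
      using exists_cong_in_interval[of "int q" r T] q by auto
    have k: "k \<le> x / c" "x / c < k + 1" unfolding k_def by linarith+
    have "?lo x * M \<le> T"
    proof -
      have "2 * (x / c) - 1 \<le> 2 * k + 1" using k by linarith
      then have "M * (2 * (x / c) - 1) / (2 * x) \<le> T"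
        unfolding T_def using M x by (intro divide_right_mono mult_left_mono) auto
      moreover have "M * (2 * (x / c) - 1) / (2 * x) = ?lo x * M" using x c by (simp add: field_simps)
      ultimately show ?thesis by simp
    qed
    then have loQ: "?lo x * M \<le> Q" using Q by linarith
    have "T \<le> M * (2 * (x / c) + 1) / (2 * x)"
      unfolding T_def using M x k by (intro divide_right_mono mult_left_mono) auto
    also have "\<dots> = (1 / c + 1 / (2 * x)) * M" using x c by (simp add: field_simps)
    finally have "Q < (1 / c + 1 / (2 * x)) * M + q" using Q by simp
    also have "\<dots> = ?hi x * M" using M by (simp add: field_simps flip: M_def)
    finally have hiQ: "Q < ?hi x * M" .
    have Tk: "x * T / M = k + 1/2" unfolding T_def using M x by (simp add: field_simps)
    have s1: "k + 1/2 \<le> x * Q / M" unfolding Tk[symmetric] using M x Q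
      by (intro divide_right_mono mult_left_mono) auto
    have "x * Q / M \<le> x * (T + q) / M" using M x Q
      by (intro divide_right_mono mult_left_mono) auto
    also have "\<dots> = k + 1/2 + ?\<eta> x" unfolding Tk[symmetric] M_def[symmetric]
      by (simp add: algebra_simps add_divide_distrib)
    finally have s2: "x * Q / M \<le> k + 1/2 + ?\<eta> x" .
    have form: "1 + E\<^sup>2 < i\<^sup>2 + (i * E + j * Q)\<^sup>2" if "(i, j) \<notin> {(0, 0), (1, 0), (-1, 0)}" for i j
    proof (rule form_exceeds_minimum[of "?lo x" E Q "?\<eta> x" k])
      show "?lo x * (1 + E\<^sup>2) \<le> Q" using loQ by (simp add: M_def x_def)
      show "k + 1/2 \<le> E * Q / (1 + (real_of_int E)\<^sup>2)" "E * Q / (1 + (real_of_int E)\<^sup>2) \<le> k + 1/2 + ?\<eta> x"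
        using s1 s2 by (simp_all add: M_def x_def)
    qed (use b that in auto)
    have "q < \<epsilon> * Q" using b(6) loQ e by (meson less_le_trans mult_left_mono order_less_imp_le)
    moreover have "c * (1 - \<epsilon>) * Q < M"
    proof -
      have "c * (1 - \<epsilon>) * Q < c * (1 - \<epsilon>) * (?hi x * M)" using hiQ c e by (intro mult_strict_left_mono) auto
      also have "\<dots> = (c * (1 - \<epsilon>) * ?hi x) * M" by (simp only: mult.assoc)
      also have "\<dots> < 1 * M" using b(4) M by (intro mult_strict_right_mono) auto
      finally show ?thesis by simp
    qed
    moreover have "M < c * (1 + \<epsilon>) * Q"
    proof -
      have "1 * M < (c * (1 + \<epsilon>) * ?lo x) * M" using b(5) M by (intro mult_strict_right_mono) auto
      also have "\<dots> = c * (1 + \<epsilon>) * (?lo x * M)" by (simp only: mult.assoc)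
      also have "\<dots> \<le> c * (1 + \<epsilon>) * Q" using loQ c e by (intro mult_left_mono) auto
      finally show ?thesis by simp
    qed
    moreover have "1 + x < \<delta> * (q * Q)"
    proof -
      have "\<delta> * q * (?lo x * M) \<le> \<delta> * q * Q" using loQ d by (intro mult_left_mono) auto
      then show ?thesis using b(7) by (simp add: mult.assoc)
    qed
    ultimately show "\<exists>Q::int. int q dvd Q - r \<and> q < \<epsilon> * Q \<and>
      c * (1 - \<epsilon>) * Q < 1 + E\<^sup>2 \<and> 1 + E\<^sup>2 < c * (1 + \<epsilon>) * Q \<and> 1 + E < \<delta> * (q * Q) \<and>
      (\<forall>i j. (i, j) \<notin> {(0, 0), (1, 0), (-1, 0)} \<longrightarrow> 1 + E\<^sup>2 < i\<^sup>2 + (i * E + j * Q)\<^sup>2)"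
      using Q(1) form by (intro exI[of _ Q]) (simp add: M_def x_def)
  qed
qed


section \<open>Approximation errors at rational points\<close>

lemma approx_err_sq_le:
  fixes g h :: int
  shows "(approx_err v k)\<^sup>2 \<le> (k * v $ 1 - g)\<^sup>2 + (k * v $ 2 - h)\<^sup>2"
proof -
  have "dist_int x \<le> \<bar>x - of_int m\<bar>" for x and m :: int
    using infdist_le[of "of_int m" "\<int>" x] by (simp add: dist_real_def)
  then have "(dist_int x)\<^sup>2 \<le> (x - of_int m)\<^sup>2" for x and m :: int
    by (metis infdist_nonneg power2_abs power_mono)
  then show ?thesis unfolding approx_err_def by (simp add: add_mono)
qed

lemma approx_err_sq_attained:
  obtains g h :: int where "(approx_err v k)\<^sup>2 = (k * v $ 1 - g)\<^sup>2 + (k * v $ 2 - h)\<^sup>2"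
  by (rule that[of "round (k * v $ 1)" "round (k * v $ 2)"]) (simp add: approx_err_def dist_int_eq_round)

lemma approx_err_nonneg: "0 \<le> approx_err v k"
  by (simp add: approx_err_def)

lemma continuous_on_approx_err: "continuous_on S (\<lambda>v. approx_err v k)"
  unfolding approx_err_def by (intro continuous_intros)

context
  fixes p P p' P' s D :: int and q Q :: nat and w :: "real ^ 2"
  assumes s: "p' * q - p * Q = s" "\<bar>s\<bar> = 1" and D: "P' * q - P * Q = D"
    and q: "0 < q" "q < Q" and w: "w = vector [p' / Q, P' / Q]"
    and form: "\<forall>i j :: int. (i, j) \<notin> {(0, 0), (1, 0), (-1, 0)} \<longrightarrow> 1 + D\<^sup>2 < i\<^sup>2 + (i * D + j * Q)\<^sup>2"
begin

lemma rational_point_err_le: "(approx_err w q)\<^sup>2 \<le> (1 + D\<^sup>2) / Q\<^sup>2"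
proof -
  have Q: "0 < real Q" using q by simp
  have "real_of_int (p' * q - p * Q) = s" "real_of_int (P' * q - P * Q) = D" using s D by simp_all
  then have "q * w $ 1 - p = s / Q" "q * w $ 2 - P = D / Q"
    using Q by (simp_all add: w field_simps)
  then have "(approx_err w q)\<^sup>2 \<le> (s / Q)\<^sup>2 + (D / Q)\<^sup>2"
    using approx_err_sq_le[of w q p P] by simp
  also have "(real_of_int s)\<^sup>2 = 1" using s(2) by (metis of_int_1 of_int_abs power2_abs power_one)
  then have "(s / Q)\<^sup>2 + (D / Q)\<^sup>2 = (1 + D\<^sup>2) / Q\<^sup>2" by (simp add: power_divide add_divide_distrib)
  finally show ?thesis .
qed

text \<open>Since \<open>s\<close> is a unit, \<open>(q, p)\<close> and \<open>(Q, p')\<close> form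
  a basis of the integer plane. In these coordinates the squared error at \<open>k\<close> is the
  form in \<open>form\<close> divided by \<open>Q\<^sup>2\<close>, and its minimal vectors with
  \<open>i \<noteq> 0\<close> force \<open>k\<close> to be \<open>q\<close> or \<open>-q\<close>
  modulo \<open>Q\<close>.\<close>

lemma rational_point_err_cases:
  assumes k: "0 < k" "k < Q"
  shows "(1 + D\<^sup>2) / Q\<^sup>2 < (approx_err w k)\<^sup>2 \<or>
    (k = q \<or> k = Q - q) \<and> (1 + D\<^sup>2) / Q\<^sup>2 = (approx_err w k)\<^sup>2"
proof -
  have Q: "0 < real Q" using q by simp
  have ss: "s * s = 1" using s(2) by (metis abs_mult_self_eq mult_1)
  obtain g h :: int where gh: "(approx_err w k)\<^sup>2 = (k * w $ 1 - g)\<^sup>2 + (k * w $ 2 - h)\<^sup>2"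
    by (rule approx_err_sq_attained)
  \<comment> \<open>Cramer's rule for \<open>(k, g) = i (q, p) + t (Q, p')\<close>; \<open>j\<close>
    is the amount by which \<open>h\<close> falls short of the second numerator
    \<open>i * P + t * P'\<close>.\<close>
  define i where "i = s * (k * p' - g * Q)"
  define t where "t = s * (g * q - k * p)"
  define j where "j = i * P + t * P' - h"
  have i2: "i\<^sup>2 = (k * p' - g * Q)\<^sup>2" unfolding i_def power_mult_distrib
    using ss by (simp add: power2_eq_square)
  have kit: "int k = i * q + t * Q"
  proof -
    have "i * q + t * Q = s * (k * (p' * q - p * Q))" unfolding i_def t_def by (simp add: algebra_simps)
    then show ?thesis using s ss by (simp add: algebra_simps)
  qed
  have y: "k * P' - h * Q = i * D + j * Q"
    unfolding kit j_def D[symmetric] by (simp add: algebra_simps)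
  have "real_of_int (k * p' - g * Q) / Q = k * w $ 1 - g" "real_of_int (k * P' - h * Q) / Q = k * w $ 2 - h"
    using Q by (simp_all add: w field_simps)
  then have "(approx_err w k)\<^sup>2 = (real_of_int (k * p' - g * Q) / Q)\<^sup>2 + (real_of_int (k * P' - h * Q) / Q)\<^sup>2"
    unfolding gh by simp
  also have "\<dots> = real_of_int ((k * p' - g * Q)\<^sup>2 + (k * P' - h * Q)\<^sup>2) / Q\<^sup>2"
    by (simp add: power_divide add_divide_distrib)
  finally have err: "(approx_err w k)\<^sup>2 = real_of_int (i\<^sup>2 + (i * D + j * Q)\<^sup>2) / Q\<^sup>2"
    unfolding i2 y .
  have i0: "i \<noteq> 0"
  proof
    assume "i = 0"
    then have "int Q dvd int k" using kit by simp
    then show False using k by (simp add: nat_dvd_not_less)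
  qed
  show ?thesis
  proof (cases "(i, j) \<in> {(0, 0), (1, 0), (-1, 0)}")
    case False
    then have "1 + D\<^sup>2 < i\<^sup>2 + (i * D + j * Q)\<^sup>2" using form by blast
    then have "real_of_int (1 + D\<^sup>2) < real_of_int (i\<^sup>2 + (i * D + j * Q)\<^sup>2)"
      by (simp only: of_int_less_iff)
    then show ?thesis unfolding err using Q by (simp add: divide_strict_right_mono)
  next
    case True
    then have ij: "j = 0" "i = 1 \<or> i = -1" using i0 by auto
    have "k = q \<or> k = Q - q" using ij(2)
    proof
      assume "i = 1"
      then have *: "int k - int q = t * Q" using kit by simp
      then have "t * int Q < 1 * int Q" "(-1) * int Q < t * int Q" using k q by linarith+
      then have "t = 0" by (simp only: mult_less_cancel_right) linarith
      then show ?thesis using * by simp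
    next
      assume "i = -1"
      then have *: "int k + int q = t * Q" using kit by simp
      then have "t * int Q < 2 * int Q" "0 * int Q < t * int Q" using k q by linarith+
      then have "t = 1" by (simp only: mult_less_cancel_right) linarith
      then have "int k + int q = int Q" using * by simp
      then show ?thesis by linarith
    qed
    moreover have "(1 + D\<^sup>2) / Q\<^sup>2 = (approx_err w k)\<^sup>2"
      unfolding err using ij by auto
    ultimately show ?thesis by blast
  qed
qed

end

section \<open>Best approximations from near-minimal denominators\<close>

lemma best_denom_step:
  assumes "infinite_best_approx v"
  shows "best_denom v n < best_denom v (Suc n)"
    and "approx_err v (best_denom v (Suc n)) < approx_err v (best_denom v n)"
    and "\<And>k. 0 < k \<Longrightarrow> k < best_denom v (Suc n) \<Longrightarrow> approx_err v (best_denom v n) \<le> approx_err v k"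
proof -
  have "better_denoms v (best_denom v n) \<noteq> {}" for n
    using assms by (simp add: infinite_best_approx_def)
  then have "best_denom v (Suc n) \<in> better_denoms v (best_denom v n)" for n
    by (metis LeastI_ex best_denom.simps(2) ex_in_conv)
  then have mem: "0 < best_denom v (Suc n)"
    "approx_err v (best_denom v (Suc n)) < approx_err v (best_denom v n)" for n
    by (auto simp: better_denoms_def)
  have min: "approx_err v (best_denom v n) \<le> approx_err v k" if "0 < k" "k < best_denom v (Suc n)" for n k
    using not_less_Least[of k "\<lambda>q. q \<in> better_denoms v (best_denom v n)"] that
    by (auto simp: better_denoms_def not_less)
  show "approx_err v (best_denom v (Suc n)) < approx_err v (best_denom v n)" by (rule mem)
  show "0 < k \<Longrightarrow> k < best_denom v (Suc n) \<Longrightarrow> approx_err v (best_denom v n) \<le> approx_err v k" for k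
    by (rule min)
  \<comment> \<open>For \<open>n = 0\<close> the new denominator is positive and differs from 1.
    Later, a new denominator below \<open>best_denom v n\<close> would by minimality have error at
    least that of the one before \<open>best_denom v n\<close>, against two strict
    decreases.\<close>
  show "best_denom v n < best_denom v (Suc n)"
  proof (cases n)
    case 0
    have "best_denom v (Suc 0) \<noteq> 1" using mem(2)[of 0] by auto
    then show ?thesis using mem(1)[of 0] 0 by simp
  next
    case (Suc m)
    show ?thesis
    proof (rule ccontr)
      assume "\<not> ?thesis"
      then have "best_denom v (Suc n) < best_denom v n \<or> best_denom v (Suc n) = best_denom v n" by linarith
      then show False
      proof
        assume "best_denom v (Suc n) < best_denom v n"
        then have "approx_err v (best_denom v m) \<le> approx_err v (best_denom v (Suc n))"
          using min[of "best_denom v (Suc n)" m] mem(1)[of n] unfolding Suc by blast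
        then show False using mem(2)[of n] mem(2)[of m] unfolding Suc by linarith
      qed (use mem(2)[of n] in simp)
    qed
  qed
qed

text \<open>\<open>q\<close> is almost the best denominator below \<open>Q\<close>; the exceptional range near \<open>Q\<close> makes room for
  the mirror image \<open>Q - q\<close>.\<close>

definition near_minimum :: "real \<Rightarrow> real \<Rightarrow> nat \<Rightarrow> nat \<Rightarrow> real ^ 2 \<Rightarrow> bool" where
  "near_minimum c \<epsilon> q Q v \<longleftrightarrow>
     Q * (approx_err v q)\<^sup>2 \<le> c * (1 + \<epsilon>) \<and>
     (\<forall>k. 0 < k \<and> k < Q \<longrightarrow> c * (1 - \<epsilon>) \<le> Q * (approx_err v k)\<^sup>2) \<and>
     (\<forall>k. 0 < k \<and> k < (1 - \<epsilon>) * Q \<longrightarrow> approx_err v q \<le> approx_err v k)"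

context
  fixes v :: "real ^ 2" and q :: "nat \<Rightarrow> nat" and c \<epsilon> :: "nat \<Rightarrow> real" and l :: real
  assumes q: "strict_mono q" "q 0 = 1"
    and near: "\<And>n. near_minimum (c n) (\<epsilon> n) (q n) (q (Suc n)) v"
    and c: "\<And>n. 0 < c n" and e: "\<And>n. 0 < \<epsilon> n" "\<And>n. \<epsilon> n < 1"
    and lim: "c \<longlonglongrightarrow> l" "\<epsilon> \<longlonglongrightarrow> 0"
begin

lemma less_denominator: "n < q n"
proof (induction n)
  case (Suc n)
  then show ?case using strict_monoD[OF q(1), of n "Suc n"] by simp
qed (simp add: q)

text \<open>The lower bounds in \<open>near_minimum\<close> exclude error 0, while the upper bounds
  make the errors at \<open>q n\<close> arbitrarily small; so every positive denominator is
  eventually beaten.\<close>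

lemma infinite_best_approx_of_near_minimum: "infinite_best_approx v"
  unfolding infinite_best_approx_def
proof
  have pos: "0 < approx_err v k" if "0 < k" for k
  proof -
    have "k < q (Suc k)" using less_denominator[of "Suc k"] by simp
    then have "c k * (1 - \<epsilon> k) \<le> q (Suc k) * (approx_err v k)\<^sup>2"
      using near[of k] that by (simp add: near_minimum_def)
    moreover have "0 < c k * (1 - \<epsilon> k)" using c e by simp
    ultimately have "approx_err v k \<noteq> 0" by auto
    then show ?thesis using approx_err_nonneg[of v k] by linarith
  qed
  have "(\<lambda>n. c n * (1 + \<epsilon> n) / real (Suc n)) \<longlonglongrightarrow> 0"
  proof -
    have "(\<lambda>n. c n * (1 + \<epsilon> n)) \<longlonglongrightarrow> l * (1 + 0)" by (intro tendsto_intros lim)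
    then have "(\<lambda>n. c n * (1 + \<epsilon> n) * (1 / real (Suc n))) \<longlonglongrightarrow> l * (1 + 0) * 0"
      by (rule tendsto_mult) (use LIMSEQ_inverse_real_of_nat in \<open>simp add: inverse_eq_divide\<close>)
    then show ?thesis by simp
  qed
  then have small: "\<exists>n. c n * (1 + \<epsilon> n) / real (Suc n) < x" if "0 < x" for x
    using that by (metis (no_types, lifting) order_tendstoD(2) eventually_happens sequentially_bot)
  have better: "better_denoms v k \<noteq> {}" if k: "0 < k" for k
  proof -
    obtain n where n: "c n * (1 + \<epsilon> n) / real (Suc n) < (approx_err v k)\<^sup>2"
      using small[of "(approx_err v k)\<^sup>2"] pos[OF k] by auto
    have "real (Suc n) * (approx_err v (q n))\<^sup>2 \<le> q (Suc n) * (approx_err v (q n))\<^sup>2"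
      using less_denominator[of "Suc n"] by (intro mult_right_mono) auto
    also have "\<dots> \<le> c n * (1 + \<epsilon> n)" using near[of n] by (simp add: near_minimum_def)
    finally have "(approx_err v (q n))\<^sup>2 \<le> c n * (1 + \<epsilon> n) / real (Suc n)" by (simp add: field_simps)
    then have "(approx_err v (q n))\<^sup>2 < (approx_err v k)\<^sup>2" using n by linarith
    then have "approx_err v (q n) < approx_err v k"
      using approx_err_nonneg power_less_imp_less_base by blast
    then have "q n \<in> better_denoms v k" using less_denominator[of n] by (simp add: better_denoms_def)
    then show ?thesis by blast
  qed
  fix n
  show "better_denoms v (best_denom v n) \<noteq> {}"
  proof (induction n)
    case (Suc n)
    then have "best_denom v (Suc n) \<in> better_denoms v (best_denom v n)"
      by (metis LeastI_ex best_denom.simps(2) ex_in_conv)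
    then show ?case by (intro better) (simp add: better_denoms_def)
  qed (simp add: better)
qed

text \<open>Each best denominator lies in some range from \<open>q n\<close> (excluded) to
  \<open>q (Suc n)\<close>, and beating \<open>q n\<close> forces it to be at least
  \<open>(1 - \<epsilon> n) * q (Suc n)\<close>. The product is then squeezed between
  \<open>c n * (1 - \<epsilon> n)\<^sup>2\<close> and \<open>c n * (1 + \<epsilon> n)\<close>, one
  factor \<open>1 - \<epsilon> n\<close> coming from the error and one from the denominator.\<close>

lemma best_denom_limit:
  "(\<lambda>n. real (best_denom v (Suc n)) * (approx_err v (best_denom v n))\<^sup>2) \<longlonglongrightarrow> l"
proof -
  note step = best_denom_step[OF infinite_best_approx_of_near_minimum]
  let ?a = "best_denom v"
  have a_ge: "n < ?a n" for n
  proof (induction n)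
    case (Suc n)
    then show ?case using step(1)[of n] by linarith
  qed simp
  have bounds: "\<exists>n\<ge>N. c n * (1 - \<epsilon> n)\<^sup>2 \<le> ?a (Suc k) * (approx_err v (?a k))\<^sup>2 \<and>
      ?a (Suc k) * (approx_err v (?a k))\<^sup>2 \<le> c n * (1 + \<epsilon> n)" if k: "q N \<le> k" for k N
  proof -
    define m where "m = (LEAST m. ?a (Suc k) \<le> q m)"
    have "?a (Suc k) \<le> q (?a (Suc k))" using less_denominator[of "?a (Suc k)"] by simp
    then have m: "?a (Suc k) \<le> q m" unfolding m_def by (rule LeastI)
    \<comment> \<open>This makes the index \<open>n\<close> at least \<open>N\<close>, so bounds
      valid for large \<open>n\<close> carry over to large \<open>k\<close>.\<close>
    have qN: "q N < ?a (Suc k)" using k a_ge[of "Suc k"] by simp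
    then have Nm: "N < m" using m strict_mono_less[OF q(1)] by (meson less_le_trans)
    then obtain n where n: "m = Suc n" using gr0_implies_Suc[of m] by auto
    have qn: "q n < ?a (Suc k)" using not_less_Least[of n "\<lambda>m. ?a (Suc k) \<le> q m"] n
      by (simp add: m_def not_le)
    have ak0: "0 < ?a k" using a_ge[of k] by simp
    have le: "approx_err v (?a k) \<le> approx_err v (q n)" using step(3)[of "q n" k] qn less_denominator[of n] by simp
    have N: "near_minimum (c n) (\<epsilon> n) (q n) (q m) v" using near[of n] n by simp
    have "?a (Suc k) * (approx_err v (?a k))\<^sup>2 \<le> q m * (approx_err v (q n))\<^sup>2"
      using m le approx_err_nonneg by (intro mult_mono power_mono) auto
    also have "\<dots> \<le> c n * (1 + \<epsilon> n)" using N by (simp add: near_minimum_def)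
    finally have upper: "?a (Suc k) * (approx_err v (?a k))\<^sup>2 \<le> c n * (1 + \<epsilon> n)" .
    \<comment> \<open>The error at \<open>?a (Suc k)\<close> is strictly below that at
      \<open>?a k\<close>, hence below that at \<open>q n\<close>; no denominator under
      \<open>(1 - \<epsilon> n) * q m\<close> achieves this.\<close>
    have late: "(1 - \<epsilon> n) * q m \<le> ?a (Suc k)"
    proof (rule ccontr)
      assume "\<not> ?thesis"
      then have "approx_err v (q n) \<le> approx_err v (?a (Suc k))"
        using N a_ge[of "Suc k"] by (auto simp: near_minimum_def)
      then show False using le step(2)[of k] by linarith
    qed
    have "?a k < q m" using m step(1)[of k] by linarith
    then have "c n * (1 - \<epsilon> n) \<le> q m * (approx_err v (?a k))\<^sup>2"
      using N ak0 by (simp add: near_minimum_def)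
    then have "(1 - \<epsilon> n) * (c n * (1 - \<epsilon> n)) \<le> (1 - \<epsilon> n) * (q m * (approx_err v (?a k))\<^sup>2)"
      using e[of n] by (intro mult_left_mono) auto
    also have "\<dots> = (1 - \<epsilon> n) * q m * (approx_err v (?a k))\<^sup>2" by simp
    also have "\<dots> \<le> ?a (Suc k) * (approx_err v (?a k))\<^sup>2" using late by (intro mult_right_mono) auto
    finally show ?thesis using upper n Nm by (intro exI[of _ n]) (auto simp: power2_eq_square mult_ac)
  qed
  have lo: "(\<lambda>n. c n * (1 - \<epsilon> n)\<^sup>2) \<longlonglongrightarrow> l"
    using tendsto_mult[OF lim(1) tendsto_power[OF tendsto_diff[OF tendsto_const lim(2)], of 1 2]] by simp
  have hi: "(\<lambda>n. c n * (1 + \<epsilon> n)) \<longlonglongrightarrow> l"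
    using tendsto_mult[OF lim(1) tendsto_add[OF tendsto_const lim(2)], of 1] by simp
  show ?thesis
  proof (rule order_tendstoI)
    fix x assume "x < l"
    then obtain N where N: "\<And>n. n \<ge> N \<Longrightarrow> x < c n * (1 - \<epsilon> n)\<^sup>2"
      using order_tendstoD(1)[OF lo] by (auto simp: eventually_sequentially)
    have "x < ?a (Suc k) * (approx_err v (?a k))\<^sup>2" if "q N \<le> k" for k
      using bounds[OF that] N by (meson less_le_trans)
    then show "\<forall>\<^sub>F k in sequentially. x < ?a (Suc k) * (approx_err v (?a k))\<^sup>2"
      by (rule eventually_sequentiallyI)
  next
    fix x assume "l < x"
    then obtain N where N: "\<And>n. n \<ge> N \<Longrightarrow> c n * (1 + \<epsilon> n) < x"
      using order_tendstoD(2)[OF hi] by (auto simp: eventually_sequentially)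
    have "?a (Suc k) * (approx_err v (?a k))\<^sup>2 < x" if "q N \<le> k" for k
      using bounds[OF that] N by (meson le_less_trans)
    then show "\<forall>\<^sub>F k in sequentially. ?a (Suc k) * (approx_err v (?a k))\<^sup>2 < x"
      by (rule eventually_sequentiallyI)
  qed
qed

end

section \<open>Cells around rational points and their refinement\<close>

text \<open>A cell is a ball around some \<open>w\<^sub>n\<close>; the fields \<open>prev_num\<close> and \<open>prev_den\<close> are \<open>p\<^sub>n\<^sub>-\<^sub>1\<close> and
  \<open>q\<^sub>n\<^sub>-\<^sub>1\<close>, starting with the formal convergent \<open>1 / 0\<close>.\<close>

datatype cell = Cell (prev_num: int) (prev_den: int) (num1: int) (num2: int) (den: nat) (rad: real)

definition center :: "cell \<Rightarrow> real ^ 2" where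
  "center s = vector [num1 s / den s, num2 s / den s]"

definition region :: "cell \<Rightarrow> (real ^ 2) set" where
  "region s = cball (center s) (rad s)"

definition valid_cell :: "cell \<Rightarrow> bool" where
  "valid_cell s \<longleftrightarrow> 0 < den s \<and> 0 < rad s \<and> \<bar>prev_num s * den s - num1 s * prev_den s\<bar> = 1"

text \<open>The conditions are imposed on the whole ball so that they pass to all later cells and to
  the limit point; \<open>b\<close> is the bit coded by this step.\<close>

definition refines :: "real \<Rightarrow> real \<Rightarrow> bool \<Rightarrow> cell \<Rightarrow> cell \<Rightarrow> bool" where
  "refines c \<epsilon> b s t \<longleftrightarrow> valid_cell t \<and> region t \<subseteq> region s \<and> den s < den t \<and>
     (\<forall>v\<in>region t. near_minimum c \<epsilon> (den s) (den t) v \<and> (center s $ 2 < v $ 2 \<longleftrightarrow> b))"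

lemma exists_large_in_residue_class:
  fixes a B :: int and q :: nat
  assumes "0 < q"
  obtains t :: int where "B \<le> \<bar>a + q * t\<bar>" "0 < a + q * t \<longleftrightarrow> b" "a + q * t \<noteq> 0"
proof -
  \<comment> \<open>Large enough that \<open>q * n\<close> outweighs \<open>a\<close>, so the sign
    of the multiplier decides the sign of the sum.\<close>
  define n where "n = \<bar>a\<bar> + max 1 B"
  have "1 * n \<le> q * n" using assms unfolding n_def by (intro mult_right_mono) auto
  moreover have "\<bar>a\<bar> + B \<le> n" "\<bar>a\<bar> + 1 \<le> n" unfolding n_def by auto
  ultimately have n: "\<bar>a\<bar> + B \<le> q * n" "\<bar>a\<bar> + 1 \<le> q * n" by linarith+
  show ?thesis
  proof (cases b)
    case True
    show ?thesis by (rule that[of n]) (use n True in linarith)+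
  next
    case False
    show ?thesis by (rule that[of "-n"]) (use n False in \<open>simp_all; linarith\<close>)+
  qed
qed

text \<open>Finitely many strict inequalities between continuous functions define an open set. At
  \<open>Q - q\<close> strictness may fail, but this denominator lies outside the range where
  \<open>near_minimum\<close> compares errors with that at \<open>q\<close>.\<close>

lemma near_minimum_neighbourhood:
  fixes w :: "real ^ 2"
  assumes e: "0 < \<epsilon>" "q < \<epsilon> * Q" and q: "0 < q" "q < Q"
    and 1: "Q * (approx_err w q)\<^sup>2 < c * (1 + \<epsilon>)"
    and 2: "\<And>k. 0 < k \<Longrightarrow> k < Q \<Longrightarrow> c * (1 - \<epsilon>) < Q * (approx_err w k)\<^sup>2"
    and 3: "\<And>k. 0 < k \<Longrightarrow> k < Q \<Longrightarrow> k \<noteq> q \<Longrightarrow> k \<noteq> Q - q \<Longrightarrow> approx_err w q < approx_err w k"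
    and y: "w $ 2 \<noteq> y" "y < w $ 2 \<longleftrightarrow> b"
  obtains r where "0 < r" "\<And>v. v \<in> cball w r \<Longrightarrow> near_minimum c \<epsilon> q Q v \<and> (y < v $ 2 \<longleftrightarrow> b)"
proof -
  let ?S = "{v. Q * (approx_err v q)\<^sup>2 < c * (1 + \<epsilon>)} \<inter>
    (\<Inter>k\<in>{0<..<Q}. {v. c * (1 - \<epsilon>) < Q * (approx_err v k)\<^sup>2}) \<inter>
    (\<Inter>k\<in>{0<..<Q} - {q, Q - q}. {v. approx_err v q < approx_err v k}) \<inter>
    (if b then {v. y < v $ 2} else {v. v $ 2 < y})"
  have "open ?S"
    by (intro open_Int open_INT)
      (auto intro!: open_Collect_less continuous_intros continuous_on_approx_err)
  moreover have "w \<in> ?S" using 1 2 3 y by auto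
  ultimately obtain r where r: "0 < r" "cball w r \<subseteq> ?S" by (meson open_contains_cball)
  show ?thesis
  proof (rule that[OF r(1)])
    fix v assume "v \<in> cball w r"
    then have v: "v \<in> ?S" using r by blast
    have "approx_err v q \<le> approx_err v k" if k: "0 < k" "k < (1 - \<epsilon>) * Q" for k
    proof (cases "k = q")
      case False
      have "k < real Q - q" using k e(2) by (simp add: algebra_simps)
      then have "k < Q - q" using q by linarith
      then show ?thesis using v False k(1) by (auto simp: less_imp_le)
    qed simp
    then have "near_minimum c \<epsilon> q Q v" using v by (auto simp: near_minimum_def less_imp_le)
    moreover have "y < v $ 2 \<longleftrightarrow> b" using v by (auto split: if_splits)
    ultimately show "near_minimum c \<epsilon> q Q v \<and> (y < v $ 2 \<longleftrightarrow> b)" by blast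
  qed
qed

text \<open>First \<open>D\<close> is fixed with large absolute value and the sign given by
  \<open>b\<close>, then \<open>Q\<close> is taken congruent to the previous denominator mod
  \<open>q\<close>, so that it is a next convergent denominator. The lattice at the new point then
  has the required shortest vector, and a small ball around it serves as the new cell.\<close>

lemma exists_refinement:
  assumes c: "0 < c" "c < 2 / sqrt 3" and e: "0 < \<epsilon>" "\<epsilon> < 1" and s: "valid_cell s"
  shows "\<exists>t. refines c \<epsilon> b s t"
proof -
  define p where "p = num1 s"
  define P where "P = num2 s"
  define q where "q = den s"
  define \<sigma> where "\<sigma> = prev_num s * den s - num1 s * prev_den s"
  have q: "0 < q" and rad: "0 < rad s" and \<sigma>: "\<bar>\<sigma>\<bar> = 1"
    using s by (auto simp: valid_cell_def q_def \<sigma>_def)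
  obtain E0 where E0: "\<And>(E::int) r. E0 \<le> E \<Longrightarrow> \<exists>Q::int. int q dvd Q - r \<and> q < \<epsilon> * Q \<and>
    c * (1 - \<epsilon>) * Q < 1 + E\<^sup>2 \<and> 1 + E\<^sup>2 < c * (1 + \<epsilon>) * Q \<and> 1 + E < rad s * (q * Q) \<and>
    (\<forall>i j. (i, j) \<notin> {(0, 0), (1, 0), (-1, 0)} \<longrightarrow> 1 + E\<^sup>2 < i\<^sup>2 + (i * E + j * Q)\<^sup>2)"
    using exists_lattice_parameters[OF c e rad q] by blast
  \<comment> \<open>\<open>D\<close> must lie in this residue class mod \<open>q\<close> for the new second numerator to be an integer.\<close>
  obtain t :: int where t: "E0 \<le> \<bar>- P * prev_den s + q * t\<bar>" "0 < - P * prev_den s + q * t \<longleftrightarrow> b"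
    "- P * prev_den s + q * t \<noteq> 0"
    by (rule exists_large_in_residue_class[OF q, of E0 "- P * prev_den s" b])
  define D where "D = - P * prev_den s + q * t"
  obtain Qi :: int where Qi: "int q dvd Qi - prev_den s" "q < \<epsilon> * Qi"
    "c * (1 - \<epsilon>) * Qi < 1 + \<bar>D\<bar>\<^sup>2" "1 + \<bar>D\<bar>\<^sup>2 < c * (1 + \<epsilon>) * Qi" "1 + \<bar>D\<bar> < rad s * (q * Qi)"
    and form: "\<And>i j. (i, j) \<notin> {(0, 0), (1, 0), (-1, 0)} \<Longrightarrow> 1 + \<bar>D\<bar>\<^sup>2 < i\<^sup>2 + (i * \<bar>D\<bar> + j * Qi)\<^sup>2"
    using E0[OF t(1), of "prev_den s"] unfolding D_def[symmetric] by auto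
  have "0 < \<epsilon> * Qi" using Qi(2) by (meson le_less_trans of_nat_0_le_iff)
  then have "0 < Qi" using e by (simp add: zero_less_mult_iff)
  then obtain Q where Q: "Qi = int Q" "0 < Q" by (metis of_nat_0_less_iff zero_less_imp_eq_int)
  have qeQ: "q < \<epsilon> * Q" using Qi(2) Q by simp
  also have "\<dots> \<le> 1 * real Q" using e by (intro mult_right_mono) auto
  finally have qQ: "q < Q" by simp
  obtain x where "Qi - prev_den s = int q * x" using Qi(1) by (rule dvdE)
  then have x: "int Q = prev_den s + int q * x" using Q by simp
  \<comment> \<open>Continued fraction recurrence with partial quotient \<open>x\<close>, preserving
    the determinant \<open>\<sigma>\<close>; \<open>P'\<close> solves
    \<open>P' * q - P * Q = D\<close>.\<close>
  define p' where "p' = x * p + prev_num s"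
  define P' where "P' = t + P * x"
  define w :: "real ^ 2" where "w = vector [p' / Q, P' / Q]"
  have \<sigma>': "p' * q - p * Q = \<sigma>"
    unfolding p'_def x \<sigma>_def p_def q_def by (simp add: algebra_simps)
  have D': "P' * q - P * Q = D" unfolding P'_def x D_def by (simp add: algebra_simps)
  \<comment> \<open>\<open>Q\<close> was selected for the absolute value of \<open>D\<close>; a
    negative \<open>D\<close> is handled by replacing \<open>i\<close> with
    \<open>-i\<close>.\<close>
  have form': "\<forall>i j :: int. (i, j) \<notin> {(0, 0), (1, 0), (-1, 0)} \<longrightarrow> 1 + D\<^sup>2 < i\<^sup>2 + (i * D + j * Q)\<^sup>2"
  proof (intro allI impI)
    fix i j :: int assume ij: "(i, j) \<notin> {(0, 0), (1, 0), (-1, 0)}"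
    show "1 + D\<^sup>2 < i\<^sup>2 + (i * D + j * Q)\<^sup>2"
    proof (cases "0 \<le> D")
      case True
      then show ?thesis using form[OF ij] Q by simp
    next
      case False
      then show ?thesis using form[of "-i" j] ij Q by auto
    qed
  qed
  note le = rational_point_err_le[OF \<sigma>' \<sigma> D' q qQ w_def form']
  note cases = rational_point_err_cases[OF \<sigma>' \<sigma> D' q qQ w_def form']
  have QQ: "Q * ((1 + (real_of_int D)\<^sup>2) / (real Q)\<^sup>2) = (1 + (real_of_int D)\<^sup>2) / Q" by (simp add: power2_eq_square)
  have M: "c * (1 - \<epsilon>) < (1 + (real_of_int D)\<^sup>2) / Q" "(1 + (real_of_int D)\<^sup>2) / Q < c * (1 + \<epsilon>)"
    using Qi(3,4) Q by (simp_all add: field_simps)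
  have "Q * (approx_err w q)\<^sup>2 \<le> (1 + (real_of_int D)\<^sup>2) / Q"
    unfolding QQ[symmetric] using le by (intro mult_left_mono) auto
  then have 1: "Q * (approx_err w q)\<^sup>2 < c * (1 + \<epsilon>)" using M by linarith
  have 2: "c * (1 - \<epsilon>) < Q * (approx_err w k)\<^sup>2" if "0 < k" "k < Q" for k
  proof -
    have "(1 + (real_of_int D)\<^sup>2) / Q \<le> Q * (approx_err w k)\<^sup>2"
      unfolding QQ[symmetric] using cases[OF that] by (intro mult_left_mono) auto
    then show ?thesis using M by linarith
  qed
  have 3: "approx_err w q < approx_err w k" if "0 < k" "k < Q" "k \<noteq> q" "k \<noteq> Q - q" for k
  proof -
    have "(approx_err w q)\<^sup>2 < (approx_err w k)\<^sup>2" using cases[OF that(1,2)] that le by auto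
    then show ?thesis using approx_err_nonneg power_less_imp_less_base by blast
  qed
  have rw: "real_of_int (p' * q - p * Q) = \<sigma>" "real_of_int (P' * q - P * Q) = D" using \<sigma>' D' by simp_all
  have diff: "w $ 1 - center s $ 1 = \<sigma> / (q * Q)" "w $ 2 - center s $ 2 = D / (q * Q)"
    using q Q rw by (simp_all add: w_def center_def p_def[symmetric] P_def[symmetric] q_def[symmetric] field_simps)
  have y: "w $ 2 \<noteq> center s $ 2" "center s $ 2 < w $ 2 \<longleftrightarrow> b"
  proof -
    have "D \<noteq> 0" "0 < D \<longleftrightarrow> b" using t by (simp_all add: D_def)
    then have "w $ 2 - center s $ 2 \<noteq> 0" "0 < w $ 2 - center s $ 2 \<longleftrightarrow> b"
      unfolding diff using q Q by (auto simp: zero_less_divide_iff mult_less_0_iff)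
    then show "w $ 2 \<noteq> center s $ 2" "center s $ 2 < w $ 2 \<longleftrightarrow> b" by simp_all
  qed
  obtain r where r: "0 < r"
    "\<And>v. v \<in> cball w r \<Longrightarrow> near_minimum c \<epsilon> q Q v \<and> (center s $ 2 < v $ 2 \<longleftrightarrow> b)"
    using near_minimum_neighbourhood[OF e(1) qeQ q qQ 1 2 3 y] by blast
  \<comment> \<open>The new centre is strictly inside the old ball, which leaves room for a ball of
    positive radius around it.\<close>
  have "dist w (center s) \<le> \<bar>w $ 1 - center s $ 1\<bar> + \<bar>w $ 2 - center s $ 2\<bar>"
    using norm_le_l1_cart[of "w - center s"] by (simp add: dist_norm sum_2)
  also have "\<dots> = (1 + \<bar>D\<bar>) / (q * Q)"
  proof -
    have "\<bar>real_of_int \<sigma>\<bar> = 1" using \<sigma> by (metis of_int_1 of_int_abs)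
    then show ?thesis unfolding diff by (simp add: abs_divide add_divide_distrib)
  qed
  also have "\<dots> < rad s" using Qi(5) q Q by (simp add: field_simps)
  finally have dist: "dist w (center s) < rad s" .
  define r' where "r' = min r (rad s - dist w (center s))"
  define u where "u = Cell p (int q) p' P' Q r'"
  have cu: "center u = w" by (simp add: u_def center_def w_def)
  have r': "0 < r'" using r dist by (simp add: r'_def)
  have "\<bar>p * Q - p' * int q\<bar> = 1" using \<sigma> \<sigma>' by linarith
  then have "valid_cell u" using r' Q by (simp add: valid_cell_def u_def)
  moreover have "region u \<subseteq> region s"
    unfolding region_def cu by (rule cball_subset_cball_iff[THEN iffD2])
      (simp add: u_def r'_def min_def)
  moreover have "v \<in> cball w r" if "v \<in> region u" for v
    using that unfolding region_def cu by (simp add: u_def r'_def)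
  ultimately have "refines c \<epsilon> b s u"
    using r(2) qQ by (simp add: refines_def u_def q_def)
  then show ?thesis by blast
qed

section \<open>Nested cells coded by sets of naturals, and their limits\<close>

text \<open>The choice at each step depends on \<open>A\<close> only through the current cell and
  the bit \<open>n \<in> A\<close>, so sets agreeing below \<open>n\<close> share their cells up to
  index \<open>n\<close>. The initial denominator 1 matches the first best denominator.\<close>

primrec cells :: "(nat \<Rightarrow> real) \<Rightarrow> (nat \<Rightarrow> real) \<Rightarrow> nat set \<Rightarrow> nat \<Rightarrow> cell" where
  "cells c \<epsilon> A 0 = Cell 1 0 0 0 1 1"
| "cells c \<epsilon> A (Suc n) = (SOME t. refines (c n) (\<epsilon> n) (n \<in> A) (cells c \<epsilon> A n) t)"

context
  fixes c \<epsilon> :: "nat \<Rightarrow> real"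
  assumes c: "\<And>n. 0 < c n" "\<And>n. c n < 2 / sqrt 3" and e: "\<And>n. 0 < \<epsilon> n" "\<And>n. \<epsilon> n < 1"
begin

lemma valid_cells: "valid_cell (cells c \<epsilon> A n)"
  and cells_refine: "refines (c n) (\<epsilon> n) (n \<in> A) (cells c \<epsilon> A n) (cells c \<epsilon> A (Suc n))"
proof -
  have step: "refines (c n) (\<epsilon> n) (n \<in> A) (cells c \<epsilon> A n) (cells c \<epsilon> A (Suc n))"
    if "valid_cell (cells c \<epsilon> A n)" for n
    using someI_ex[OF exists_refinement[OF c e that]] by simp
  have valid: "valid_cell (cells c \<epsilon> A n)" for n
  proof (induction n)
    case (Suc n)
    then show ?case using step by (simp only: refines_def)
  qed (simp add: valid_cell_def)
  then show "valid_cell (cells c \<epsilon> A n)"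
    and "refines (c n) (\<epsilon> n) (n \<in> A) (cells c \<epsilon> A n) (cells c \<epsilon> A (Suc n))"
    using step by blast+
qed

lemma exists_cell_limit: "\<exists>v. \<forall>n. v \<in> region (cells c \<epsilon> A n)"
proof -
  have "region (cells c \<epsilon> A n) \<subseteq> region (cells c \<epsilon> A m)" if "m \<le> n" for m n
    using that
  proof (induction rule: dec_induct)
    case (step n)
    then show ?case using cells_refine[of n A] unfolding refines_def by blast
  qed simp
  moreover have "region (cells c \<epsilon> A n) \<noteq> {}" for n
    using valid_cells[of A n] by (simp add: region_def valid_cell_def)
  ultimately have "\<Inter>(range (\<lambda>n. region (cells c \<epsilon> A n))) \<noteq> {}"
    by (intro compact_nest) (auto simp: region_def)
  then show ?thesis by blast
qed

definition cell_limit :: "nat set \<Rightarrow> real ^ 2" where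
  "cell_limit A = (SOME v. \<forall>n. v \<in> region (cells c \<epsilon> A n))"

lemma cell_limit_mem: "cell_limit A \<in> region (cells c \<epsilon> A n)"
  using someI_ex[OF exists_cell_limit[of A]] unfolding cell_limit_def by blast

lemma cell_limit_near_minimum:
  "near_minimum (c n) (\<epsilon> n) (den (cells c \<epsilon> A n)) (den (cells c \<epsilon> A (Suc n))) (cell_limit A)"
  using cells_refine[of n A] cell_limit_mem[of A "Suc n"] unfolding refines_def by blast

lemma strict_mono_den_cells: "strict_mono (\<lambda>n. den (cells c \<epsilon> A n))"
  using cells_refine by (simp add: strict_mono_Suc_iff refines_def del: cells.simps)

text \<open>As long as the cells for \<open>A\<close> and \<open>B\<close> coincide, the side of
  their common centre on which the common limit lies determines the next bit, so the next cells
  coincide too.\<close>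

lemma inj_cell_limit: "inj cell_limit"
proof (rule injI)
  fix A B assume AB: "cell_limit A = cell_limit B"
  have bit: "n \<in> X \<longleftrightarrow> center (cells c \<epsilon> X n) $ 2 < cell_limit X $ 2" for X n
    using cells_refine[of n X] cell_limit_mem[of X "Suc n"] unfolding refines_def by blast
  have "cells c \<epsilon> A n = cells c \<epsilon> B n" for n
  proof (induction n)
    case (Suc n)
    then have "n \<in> A \<longleftrightarrow> n \<in> B" using bit AB by simp
    then show ?case using Suc by simp
  qed simp
  then show "A = B" using bit AB by (metis subsetI subset_antisym)
qed

end

theorem theorem2:
  fixes l :: real
  assumes "l \<in> {0 .. 2 / sqrt 3}"
  shows "\<exists>S :: (real ^ 2) set. S \<approx> (UNIV :: real set) \<and>
    (\<forall>v\<in>S. infinite_best_approx v \<and>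
       (\<forall>p. best_numerators v p \<longrightarrow>
          (\<lambda>n. 1 / pi * cyl_volume v p (n + 1)) \<longlonglongrightarrow> l \<and>
          (\<lambda>n. real (best_denom v (n + 1)) * (best_dist v p n)\<^sup>2) \<longlonglongrightarrow> l))"
proof -
  \<comment> \<open>The shift by 2 keeps \<open>\<epsilon> n\<close> strictly below 1 already at
    \<open>n = 0\<close>.\<close>
  define \<epsilon> where "\<epsilon> = (\<lambda>n. 1 / (real n + 2))"
  \<comment> \<open>Mixing with the interior point 1 keeps \<open>c n\<close> strictly inside the interval.\<close>
  define c where "c = (\<lambda>n. (1 - \<epsilon> n) * l + \<epsilon> n * 1)"
  have e: "0 < \<epsilon> n" "\<epsilon> n < 1" for n by (simp_all add: \<epsilon>_def)
  have elim: "\<epsilon> \<longlonglongrightarrow> 0" unfolding \<epsilon>_def by real_asymp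
  have "sqrt 3 < sqrt 4" by (intro real_sqrt_less_mono) simp
  then have one: "1 < 2 / sqrt 3" by simp
  have c: "0 < c n" "c n < 2 / sqrt 3" for n
  proof -
    have "0 \<le> (1 - \<epsilon> n) * l" using assms e[of n] by auto
    then show "0 < c n" using e[of n] by (simp add: c_def)
    have "(1 - \<epsilon> n) * l \<le> (1 - \<epsilon> n) * (2 / sqrt 3)"
      using assms e[of n] by (intro mult_left_mono) auto
    moreover have "\<epsilon> n * 1 < \<epsilon> n * (2 / sqrt 3)" using one e[of n] by (intro mult_strict_left_mono)
    ultimately show "c n < 2 / sqrt 3" unfolding c_def by (simp only: left_diff_distrib)
  qed
  have "c \<longlonglongrightarrow> (1 - 0) * l + 0 * 1" unfolding c_def by (intro tendsto_intros elim)
  then have clim: "c \<longlonglongrightarrow> l" by simp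
  define f where "f = cell_limit c \<epsilon>"
  have inj: "inj f" unfolding f_def by (rule inj_cell_limit[OF c e])
  have "range f \<approx> (UNIV :: real set)"
    using inj_on_image_eqpoll_self[OF inj] nat_sets_eqpoll_reals eqpoll_trans by blast
  moreover have "infinite_best_approx (f A) \<and>
       (\<forall>p. best_numerators (f A) p \<longrightarrow>
          (\<lambda>n. 1 / pi * cyl_volume (f A) p (n + 1)) \<longlonglongrightarrow> l \<and>
          (\<lambda>n. real (best_denom (f A) (n + 1)) * (best_dist (f A) p n)\<^sup>2) \<longlonglongrightarrow> l)" for A
  proof -
    have near: "near_minimum (c n) (\<epsilon> n) (den (cells c \<epsilon> A n)) (den (cells c \<epsilon> A (Suc n))) (f A)" for n
      unfolding f_def by (rule cell_limit_near_minimum[OF c e])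
    have mono: "strict_mono (\<lambda>n. den (cells c \<epsilon> A n))" by (rule strict_mono_den_cells[OF c e])
    have zero: "den (cells c \<epsilon> A 0) = 1" by simp
    note facts = mono zero near c(1) e clim elim
    have lim: "(\<lambda>n. real (best_denom (f A) (n + 1)) * (best_dist (f A) p n)\<^sup>2) \<longlonglongrightarrow> l"
      if "best_numerators (f A) p" for p
      using best_denom_limit[OF facts] by (simp add: best_dist_eq_approx_err[OF that])
    have "1 / pi * cyl_volume (f A) p (n + 1) = real (best_denom (f A) (n + 1)) * (best_dist (f A) p n)\<^sup>2"
      for p n by (simp add: cyl_volume_def cyl_radius_def)
    then show ?thesis using infinite_best_approx_of_near_minimum[OF facts] lim by simp
  qed
  ultimately show ?thesis by (intro exI[of _ "range f"]) auto
qed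

end
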